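(* Let $n\ge d$ be positive integers and let $f=g(e_1,\dots,e_d)$ be a hook-shaped polynomial of degree $d$ in $n$ variables. Then $f$ is copositive if and only if $g\left(1,\binom{k}{2}\frac{1}{k^2},\dots,\binom{k}{d}\frac1{k^d}\right)\ge0$ for all $k\in\{1,\dots,n\}$.
   Context: $e_k(x)=\sum_{I\subset\{1,\dots,n\},|I|=k}\prod_{i\in I}x_i$ is the $k$-th elementary symmetric polynomial in $n$ variables. A hook-shaped polynomial of degree $d$ is a symmetric form of the shape $f=g(e_1,\dots,e_d)$ with $g(e_1,\dots,e_d)=c_1e_1^d+c_2e_1^{d-2}e_2+c_3e_1^{d-3}e_3+\dots+c_de_d$, where $c_1,\dots,c_d\in\mathbb{R}$ (so only $e_1$ occurs nonlinearly). A polynomial in $n$ variables is copositive if it is nonnegative on $\mathbb{R}^n_{\ge0}$. *)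

theory Defs
  imports "HOL-Analysis.Analysis"
begin

text \<open>Real polynomials are represented by the polynomial functions they induce.\<close>

definition elem_sym :: "nat \<Rightarrow> real ^ 'n \<Rightarrow> real" where
  "elem_sym k x = (\<Sum>I | I \<subseteq> (UNIV :: 'n set) \<and> card I = k. \<Prod>i\<in>I. x $ i)"

text \<open>
  The argument \<open>y\<close> stands for the tuple \<open>(y 1, ..., y d)\<close> of the variables of \<open>g\<close>;
  the values of \<open>y\<close> at other indices are irrelevant. The coefficients are \<open>c 1, ..., c d\<close>.
\<close>

definition hook_shaped :: "nat \<Rightarrow> ((nat \<Rightarrow> real) \<Rightarrow> real) \<Rightarrow> bool" where
  "hook_shaped d g \<longleftrightarrow>
     (\<exists>c :: nat \<Rightarrow> real. g = (\<lambda>y. c 1 * y 1 ^ d + (\<Sum>j = 2..d. c j * y 1 ^ (d - j) * y j)))"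

definition copositive :: "(real ^ 'n \<Rightarrow> real) \<Rightarrow> bool" where
  "copositive f \<longleftrightarrow> (\<forall>x. (\<forall>i. 0 \<le> x $ i) \<longrightarrow> 0 \<le> f x)"

end

theory Submission
  imports Defs
begin

text \<open>
  A hook-shaped form is homogeneous of degree \<open>d\<close>, so its sign on the nonnegative orthant is
  decided on the standard simplex. There \<open>e\<^sub>1 = 1\<close>, and the form becomes a constant plus a linear
  combination of \<open>e\<^sub>2, \<dots>, e\<^sub>d\<close>. This is where the hook shape enters: such a
  combination is affine in each coordinate and symmetric, so if all coordinates except two, \<open>u\<close> and
  \<open>v\<close>, are fixed, and the sum \<open>u + v\<close> is fixed as well, then it is an affine function of the
  product \<open>u v\<close> alone (lemma \<open>elem_sym_replace_pair\<close>).

  A function on the simplex with this property attains its minimum at the barycenter of a face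
  (lemma \<open>simplex_minimum_at_barycenter\<close>). Take a minimizer with as few nonzero coordinates as
  possible, and suppose that two of its nonzero coordinates differ. Their product
  lies strictly between the extreme values \<open>0\<close> and \<open>(u + v)\<^sup>2 / 4\<close>
  that are possible for the given sum. An affine function with a minimum at an interior point is
  constant, so \<open>(u, v)\<close> may be replaced by \<open>(u + v, 0)\<close>, which gives a minimizer with fewer
  nonzero coordinates.

  At the barycenter of a face with \<open>k\<close> vertices, \<open>e\<^sub>j\<close> has the value
  \<open>(k choose j) / k ^ j\<close>, so the values of the form at these points are exactly the
  numbers in the criterion.
\<close>

section \<open>Elementary symmetric polynomials\<close>

text \<open>
  The sum is taken over the subsets of an arbitrary index set \<open>S\<close>, because splitting off
  a variable leads to the remaining variables.
\<close>

definition elem_sym_on :: "'n set \<Rightarrow> nat \<Rightarrow> real ^ 'n \<Rightarrow> real" where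
  "elem_sym_on S k x = (\<Sum>I | I \<subseteq> S \<and> card I = k. \<Prod>i\<in>I. x $ i)"

lemma elem_sym_eq_elem_sym_on: "elem_sym k x = elem_sym_on UNIV k x"
  by (simp add: elem_sym_def elem_sym_on_def)

lemma elem_sym_on_cong:
  assumes "\<And>i. i \<in> S \<Longrightarrow> x $ i = y $ i"
  shows "elem_sym_on S k x = elem_sym_on S k y"
  unfolding elem_sym_on_def using assms by (intro sum.cong refl prod.cong) auto

text \<open>
  The subsets of \<open>insert a S\<close> with \<open>k + 1\<close> elements are those that avoid \<open>a\<close>, and the
  sets \<open>insert a J\<close> with \<open>J \<subseteq> S\<close> of size \<open>k\<close>.
\<close>

lemma elem_sym_on_insert:
  fixes x :: "real ^ 'n"
  assumes "a \<notin> S"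
  shows "elem_sym_on (insert a S) (Suc k) x = elem_sym_on S (Suc k) x + x $ a * elem_sym_on S k x"
proof -
  let ?A = "{I. I \<subseteq> S \<and> card I = Suc k}" and ?B = "{J. J \<subseteq> S \<and> card J = k}"
  have split: "{I. I \<subseteq> insert a S \<and> card I = Suc k} = ?A \<union> insert a ` ?B"
  proof (intro set_eqI iffI)
    fix I assume I: "I \<in> {I. I \<subseteq> insert a S \<and> card I = Suc k}"
    show "I \<in> ?A \<union> insert a ` ?B"
    proof (cases "a \<in> I")
      case True
      with I have "I = insert a (I - {a})" "I - {a} \<in> ?B" by auto
      then show ?thesis by blast
    qed (use I in auto)
  qed (use assms in \<open>auto simp: card_insert_if\<close>)
  have inj: "inj_on (insert a) ?B"
    using assms by (auto simp: inj_on_def insert_ident subset_iff)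
  have "(\<Sum>I\<in>insert a ` ?B. \<Prod>i\<in>I. x $ i) = (\<Sum>J\<in>?B. x $ a * (\<Prod>i\<in>J. x $ i))"
    unfolding sum.reindex[OF inj] comp_def
    using assms by (intro sum.cong refl prod.insert) auto
  moreover have "?A \<inter> insert a ` ?B = {}"
    using assms by auto
  ultimately show ?thesis
    unfolding elem_sym_on_def split by (subst sum.union_disjoint) (auto simp: sum_distrib_left)
qed

definition replace_pair :: "'n \<Rightarrow> 'n \<Rightarrow> real \<Rightarrow> real \<Rightarrow> real ^ 'n \<Rightarrow> real ^ 'n" where
  "replace_pair a b u v x = (\<chi> i. if i = a then u else if i = b then v else x $ i)"

text \<open>
  Splitting off both coordinates gives \<open>e\<^bsub>j+2\<^esub> = E\<^bsub>j+2\<^esub> + (u + v) E\<^bsub>j+1\<^esub> + u v E\<^bsub>j\<^esub>\<close>, where \<open>E\<close>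
  denotes the elementary symmetric polynomials in the other coordinates.
\<close>

lemma elem_sym_replace_pair:
  fixes x :: "real ^ 'n"
  assumes "a \<noteq> b" "2 \<le> j"
  shows "\<exists>A C. \<forall>u v. u + v = s \<longrightarrow> elem_sym j (replace_pair a b u v x) = A + C * (u * v)"
proof -
  define R where "R = UNIV - {a, b}"
  obtain k where j: "j = Suc (Suc k)"
    using assms(2) by (metis add_2_eq_Suc le_Suc_ex)
  define E where "E i = elem_sym_on R i x" for i
  have "elem_sym j (replace_pair a b u v x) = E j + (u + v) * E (Suc k) + u * v * E k" for u v
  proof -
    let ?y = "replace_pair a b u v x"
    have UNIV_split: "(UNIV :: 'n set) = insert a (insert b R)"
      by (auto simp: R_def)
    have "elem_sym_on R i ?y = E i" for i
      unfolding E_def by (rule elem_sym_on_cong) (auto simp: R_def replace_pair_def)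
    moreover have "a \<notin> insert b R" "b \<notin> R" "?y $ a = u" "?y $ b = v"
      using assms(1) by (auto simp: R_def replace_pair_def)
    ultimately show ?thesis
      unfolding elem_sym_eq_elem_sym_on UNIV_split j by (simp add: elem_sym_on_insert algebra_simps)
  qed
  then show ?thesis
    by (intro exI[of _ "E j + s * E (Suc k)"] exI[of _ "E k"]) (auto simp: algebra_simps)
qed

lemma elem_sym_1: "elem_sym 1 x = (\<Sum>i\<in>UNIV. x $ i)"
proof -
  have "{I :: 'a set. I \<subseteq> UNIV \<and> card I = 1} = (\<lambda>i. {i}) ` UNIV"
    by (auto simp: card_1_singleton_iff)
  then show ?thesis
    by (simp add: elem_sym_def sum.reindex)
qed

lemma elem_sym_scaleR: "elem_sym k (t *\<^sub>R x) = t ^ k * elem_sym k x"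
  unfolding elem_sym_def sum_distrib_left
  by (intro sum.cong refl) (auto simp: prod.distrib)

lemma continuous_on_elem_sym: "continuous_on S (elem_sym k)"
  unfolding elem_sym_def by (intro continuous_intros)

definition barycenter :: "'n set \<Rightarrow> real ^ 'n" where
  "barycenter S = (\<chi> i. if i \<in> S then 1 / real (card S) else 0)"

text \<open>
  Only the index sets inside \<open>S\<close> contribute, and each contributes the same product.
\<close>

lemma elem_sym_barycenter:
  fixes S :: "'n::finite set"
  shows "elem_sym j (barycenter S) = real (card S choose j) * (1 / real (card S) ^ j)"
proof -
  let ?t = "1 / real (card S)"
  have "elem_sym j (barycenter S)
      = (\<Sum>I | I \<subseteq> S \<and> card I = j. \<Prod>i\<in>I. barycenter S $ i)"
    unfolding elem_sym_def
    by (rule sum.mono_neutral_right) (auto simp: barycenter_def intro!: prod_zero)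
  also have "\<dots> = (\<Sum>I | I \<subseteq> S \<and> card I = j. ?t ^ j)"
  proof (intro sum.cong refl)
    fix I assume "I \<in> {I. I \<subseteq> S \<and> card I = j}"
    then have "I \<subseteq> S" "card I = j" by auto
    have "(\<Prod>i\<in>I. barycenter S $ i) = (\<Prod>i\<in>I. ?t)"
      using \<open>I \<subseteq> S\<close> by (intro prod.cong) (auto simp: barycenter_def)
    then show "(\<Prod>i\<in>I. barycenter S $ i) = ?t ^ j"
      using \<open>card I = j\<close> by simp
  qed
  finally show ?thesis
    by (simp add: n_subsets power_one_over)
qed

section \<open>Minima on the standard simplex\<close>

definition std_simplex :: "(real ^ 'n) set" where
  "std_simplex = {x. (\<forall>i. 0 \<le> x $ i) \<and> (\<Sum>i\<in>UNIV. x $ i) = 1}"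

lemma compact_simplex: "compact (std_simplex :: (real ^ 'n) set)"
proof (subst compact_eq_bounded_closed, intro conjI)
  have "norm x \<le> 1" if "x \<in> std_simplex" for x :: "real ^ 'n"
    using that norm_le_l1_cart[of x] by (simp add: std_simplex_def)
  then show "bounded (std_simplex :: (real ^ 'n) set)"
    by (auto simp: bounded_iff)
  show "closed (std_simplex :: (real ^ 'n) set)"
    unfolding std_simplex_def
    by (intro closed_Collect_conj closed_Collect_all closed_Collect_le closed_Collect_eq
        continuous_intros)
qed

lemma barycenter_in_simplex: "S \<noteq> {} \<Longrightarrow> barycenter S \<in> std_simplex"
  by (auto simp: std_simplex_def barycenter_def sum.If_cases)

lemma replace_pair_in_simplex:
  assumes "x \<in> std_simplex" "a \<noteq> b" "0 \<le> u" "0 \<le> v" "u + v = x $ a + x $ b"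
  shows "replace_pair a b u v x \<in> std_simplex"
proof -
  have split: "(\<Sum>i\<in>UNIV. y $ i) = y $ a + (y $ b + (\<Sum>i\<in>UNIV - {a} - {b}. y $ i))"
    for y :: "real ^ 'a"
    using assms(2) sum.remove[of UNIV a "($) y"] sum.remove[of "UNIV - {a}" b "($) y"] by simp
  have "(\<Sum>i\<in>UNIV - {a} - {b}. replace_pair a b u v x $ i) = (\<Sum>i\<in>UNIV - {a} - {b}. x $ i)"
    by (intro sum.cong) (auto simp: replace_pair_def)
  with assms show ?thesis
    unfolding std_simplex_def split by (auto simp: replace_pair_def)
qed

text \<open>
  A minimizer with the fewest nonzero coordinates is a barycenter: two different nonzero
  coordinates could be merged into one without changing the value.
\<close>

lemma simplex_minimum_at_barycenter:
  fixes \<phi> :: "real ^ 'n \<Rightarrow> real"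
  assumes cont: "continuous_on std_simplex \<phi>"
    and pair: "\<And>x a b s. a \<noteq> b \<Longrightarrow>
      \<exists>A C. \<forall>u v. u + v = s \<longrightarrow> \<phi> (replace_pair a b u v x) = A + C * (u * v)"
  obtains S where "S \<noteq> {}" "\<And>y. y \<in> std_simplex \<Longrightarrow> \<phi> (barycenter S) \<le> \<phi> y"
proof -
  define supp where "supp x = {i. x $ i \<noteq> 0}" for x :: "real ^ 'n"
  define minimizer where "minimizer x \<longleftrightarrow> x \<in> std_simplex \<and> (\<forall>y\<in>std_simplex. \<phi> x \<le> \<phi> y)" for x
  have "std_simplex \<noteq> ({} :: (real ^ 'n) set)"
    using barycenter_in_simplex[of "UNIV :: 'n set"] by auto
  then obtain x0 where "minimizer x0"
    using continuous_attains_inf[OF compact_simplex _ cont] unfolding minimizer_def by blast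
  then obtain x where x: "minimizer x"
    and least: "\<And>y. minimizer y \<Longrightarrow> card (supp x) \<le> card (supp y)"
    using ex_has_least_nat[of minimizer x0 "\<lambda>y. card (supp y)"] by blast
  have x_simplex: "x \<in> std_simplex" and x_min: "\<And>y. y \<in> std_simplex \<Longrightarrow> \<phi> x \<le> \<phi> y"
    using x by (auto simp: minimizer_def)
  have equal: "x $ a = x $ b" if "a \<in> supp x" "b \<in> supp x" for a b
  proof (rule ccontr)
    assume neq: "x $ a \<noteq> x $ b"
    then have ab: "a \<noteq> b" by auto
    define s p where "s = x $ a + x $ b" and "p = x $ a * x $ b"
    have pos: "0 < x $ a" "0 < x $ b"
      using that x_simplex by (auto simp: supp_def std_simplex_def less_le)
    obtain A C where AC: "\<And>u v. u + v = s \<Longrightarrow> \<phi> (replace_pair a b u v x) = A + C * (u * v)"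
      using pair[OF ab, of s x] by blast
    have "replace_pair a b (x $ a) (x $ b) x = x"
      by (auto simp: replace_pair_def vec_eq_iff)
    then have value_x: "\<phi> x = A + C * p"
      using AC[of "x $ a" "x $ b"] by (simp add: s_def p_def)
    let ?y = "replace_pair a b s 0 x"
    \<comment> \<open>The two extreme products: merging gives \<open>0\<close>, averaging gives \<open>s\<^sup>2 / 4\<close>. Comparing both with
      the minimizer forces the slope \<open>C\<close> to vanish.\<close>
    have y: "?y \<in> std_simplex"
      using pos x_simplex ab by (intro replace_pair_in_simplex) (auto simp: s_def)
    have z: "replace_pair a b (s / 2) (s / 2) x \<in> std_simplex"
      using pos x_simplex ab by (intro replace_pair_in_simplex) (auto simp: s_def)
    have "C * p \<le> 0"
      using x_min[OF y] AC[of s 0] value_x by simp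
    moreover have "0 \<le> C * (s / 2 * (s / 2) - p)"
      using x_min[OF z] AC[of "s / 2" "s / 2"] value_x by (simp add: algebra_simps)
    moreover have "0 < p"
      using pos by (simp add: p_def)
    moreover have "0 < s / 2 * (s / 2) - p"
    proof -
      have "s / 2 * (s / 2) - p = ((x $ a - x $ b) / 2)\<^sup>2"
        by (simp add: s_def p_def power2_eq_square field_simps)
      then show ?thesis using neq by simp
    qed
    ultimately have "C = 0"
      by (simp add: mult_le_0_iff zero_le_mult_iff)
    then have "minimizer ?y"
      using y x_min AC[of s 0] value_x by (simp add: minimizer_def)
    moreover have "card (supp ?y) < card (supp x)"
      using that ab by (intro psubset_card_mono) (auto simp: supp_def replace_pair_def split: if_splits)
    ultimately show False
      using least by fastforce
  qed
  have sum_supp: "(\<Sum>i\<in>supp x. x $ i) = 1"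
  proof -
    have "(\<Sum>i\<in>supp x. x $ i) = (\<Sum>i\<in>UNIV. x $ i)"
      by (rule sum.mono_neutral_left) (auto simp: supp_def)
    then show ?thesis using x_simplex by (simp add: std_simplex_def)
  qed
  have "x = barycenter (supp x)"
  proof (subst vec_eq_iff, intro allI)
    fix i
    show "x $ i = barycenter (supp x) $ i"
    proof (cases "i \<in> supp x")
      case True
      then have "(\<Sum>j\<in>supp x. x $ j) = (\<Sum>j\<in>supp x. x $ i)"
        by (intro sum.cong refl equal)
      with sum_supp have "real (card (supp x)) * x $ i = 1" by simp
      then have "x $ i = inverse (real (card (supp x)))"
        by (metis inverse_unique)
      with True show ?thesis
        by (simp add: barycenter_def inverse_eq_divide)
    qed (auto simp: barycenter_def supp_def)
  qed
  moreover have "supp x \<noteq> {}"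
    using sum_supp by auto
  ultimately show thesis
    using that x_min by metis
qed

section \<open>Hook-shaped forms\<close>

text \<open>
  The origin, which has no projection to the simplex, is the multiple \<open>0\<close> of any of its points.
\<close>

lemma nonneg_eq_scaleR_simplex:
  fixes x :: "real ^ 'n"
  assumes "\<And>i. 0 \<le> x $ i"
  obtains t y where "0 \<le> t" "y \<in> std_simplex" "x = t *\<^sub>R y"
proof (cases "x = 0")
  case True
  then show thesis
    using that[of 0 "barycenter UNIV"] barycenter_in_simplex[of "UNIV :: 'n set"] by simp
next
  case False
  define t where "t = (\<Sum>i\<in>UNIV. x $ i)"
  have "t \<noteq> 0"
    using False assms by (auto simp: t_def sum_nonneg_eq_0_iff vec_eq_iff)
  moreover have "0 \<le> t"
    using assms by (simp add: t_def sum_nonneg)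
  ultimately have "(1 / t) *\<^sub>R x \<in> std_simplex"
    using assms by (auto simp: std_simplex_def sum_divide_distrib[symmetric] t_def)
  with \<open>0 \<le> t\<close> \<open>t \<noteq> 0\<close> show thesis
    using that[of t "(1 / t) *\<^sub>R x"] by simp
qed

theorem theorem5p8:
  fixes f :: "real ^ 'n \<Rightarrow> real"
    and g :: "(nat \<Rightarrow> real) \<Rightarrow> real"
    and d :: nat
  assumes "1 \<le> d" and "d \<le> CARD('n)"
    and "hook_shaped d g"
    and "f = (\<lambda>x. g (\<lambda>j. elem_sym j x))"
  shows "copositive f \<longleftrightarrow>
    (\<forall>k \<in> {1..CARD('n)}.
       0 \<le> g (\<lambda>j. if j = 1 then 1 else real (k choose j) * (1 / real k ^ j)))"
proof -
  obtain c where g: "g = (\<lambda>y. c 1 * y 1 ^ d + (\<Sum>j = 2..d. c j * y 1 ^ (d - j) * y j))"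
    using assms(3) by (auto simp: hook_shaped_def)
  have f: "f x = c 1 * elem_sym 1 x ^ d + (\<Sum>j = 2..d. c j * elem_sym 1 x ^ (d - j) * elem_sym j x)"
    for x
    by (simp add: assms(4) g)
  define \<phi> :: "real ^ 'n \<Rightarrow> real" where "\<phi> x = c 1 + (\<Sum>j = 2..d. c j * elem_sym j x)" for x
  have f_simplex: "f x = \<phi> x" if "x \<in> std_simplex" for x
    using that by (simp add: f \<phi>_def elem_sym_1[unfolded One_nat_def] std_simplex_def)
  have f_scaleR: "f (t *\<^sub>R x) = t ^ d * f x" for t x
  proof -
    have "c j * (t ^ 1 * elem_sym 1 x) ^ (d - j) * (t ^ j * elem_sym j x)
        = t ^ d * (c j * elem_sym 1 x ^ (d - j) * elem_sym j x)" if "j \<in> {2..d}" for j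
    proof -
      have "t ^ d = t ^ (d - j) * t ^ j"
        using that by (simp flip: power_add)
      then show ?thesis by (simp add: power_mult_distrib)
    qed
    then show ?thesis
      unfolding f elem_sym_scaleR distrib_left sum_distrib_left
      by (intro arg_cong2[where f = "(+)"] sum.cong refl) (simp_all add: power_mult_distrib)
  qed
  have f_barycenter: "f (barycenter S)
      = g (\<lambda>j. if j = 1 then 1 else real (card S choose j) * (1 / real (card S) ^ j))"
    if "S \<noteq> {}" for S
  proof -
    have "elem_sym 1 (barycenter S) = 1"
      using barycenter_in_simplex[OF that] by (simp only: elem_sym_1) (simp add: std_simplex_def)
    then have "(\<lambda>j. elem_sym j (barycenter S))
        = (\<lambda>j. if j = 1 then 1 else real (card S choose j) * (1 / real (card S) ^ j))"
      by (intro ext) (auto simp: elem_sym_barycenter)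
    then show ?thesis by (simp only: assms(4))
  qed
  show ?thesis
  proof (intro iffI ballI)
    fix k assume cop: "copositive f" and k: "k \<in> {1..CARD('n)}"
    obtain S :: "'n set" where S: "card S = k"
      using k obtain_subset_with_card_n[of k "UNIV :: 'n set"] by auto
    with k have "S \<noteq> {}" by auto
    moreover have "0 \<le> f (barycenter S)"
      using cop by (simp add: copositive_def barycenter_def)
    ultimately show "0 \<le> g (\<lambda>j. if j = 1 then 1 else real (k choose j) * (1 / real k ^ j))"
      using f_barycenter[of S] unfolding S by simp
  next
    assume crit: "\<forall>k \<in> {1..CARD('n)}.
       0 \<le> g (\<lambda>j. if j = 1 then 1 else real (k choose j) * (1 / real k ^ j))"
    have "continuous_on std_simplex \<phi>"
      unfolding \<phi>_def by (intro continuous_intros continuous_on_elem_sym)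
    moreover have "\<exists>A C. \<forall>u v. u + v = s \<longrightarrow> \<phi> (replace_pair a b u v x) = A + C * (u * v)"
      if "a \<noteq> b" for x a b s
    proof -
      have "\<forall>j\<in>{2..d}. \<exists>A C. \<forall>u v. u + v = s \<longrightarrow>
          elem_sym j (replace_pair a b u v x) = A + C * (u * v)"
        using elem_sym_replace_pair[OF that] by simp
      then obtain A C where "\<And>j u v. j \<in> {2..d} \<Longrightarrow> u + v = s \<Longrightarrow>
          elem_sym j (replace_pair a b u v x) = A j + C j * (u * v)"
        by metis
      then have "\<phi> (replace_pair a b u v x)
          = (c 1 + (\<Sum>j = 2..d. c j * A j)) + (\<Sum>j = 2..d. c j * C j) * (u * v)"
        if "u + v = s" for u v
        using that by (simp add: \<phi>_def sum_distrib_right distrib_left sum.distrib mult.assoc)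
      then show ?thesis by blast
    qed
    ultimately obtain S where S: "S \<noteq> {}" and min: "\<And>y. y \<in> std_simplex \<Longrightarrow> \<phi> (barycenter S) \<le> \<phi> y"
      by (rule simplex_minimum_at_barycenter) blast+
    have "card S \<in> {1..CARD('n)}"
      using S by (simp add: Suc_le_eq card_gt_0_iff card_mono)
    then have "0 \<le> \<phi> (barycenter S)"
      using crit f_barycenter[OF S] f_simplex[OF barycenter_in_simplex[OF S]] by simp
    then have simplex_nonneg: "0 \<le> f y" if "y \<in> std_simplex" for y
      using min[OF that] f_simplex[OF that] by simp
    show "copositive f"
      unfolding copositive_def
    proof (intro allI impI)
      fix x :: "real ^ 'n" assume "\<forall>i. 0 \<le> x $ i"
      then obtain t y where "0 \<le> t" "y \<in> std_simplex" "x = t *\<^sub>R y"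
        using nonneg_eq_scaleR_simplex by blast
      then show "0 \<le> f x"
        using simplex_nonneg by (simp add: f_scaleR)
    qed
  qed
qed

end
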